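(* Let $(\mathcal{X}, \|\cdot\|_{\mathcal{X}})$ be a real Banach space with a strictly convex norm and let $T:\ell_1([0,1])\rightarrow \mathcal{X}$ be a compact bounded injective linear operator. Define $\|x\|_T=\|x\|_1+\|T(x)\|_{\mathcal{X}}$ for $x\in \ell_1([0,1])$. Then the equivalent renorming $(\ell_1([0,1]), \|\cdot\|_T)$ of $(\ell_1([0,1]), \|\cdot\|_1)$ admits no infinite equilateral set.
   Context: All Banach spaces are over the reals. $\ell_1([0,1])$ is the space of all functions $x:[0,1]\to\mathbb{R}$ with $\|x\|_1=\sum_{t\in[0,1]}|x(t)|<\infty$ (so $[0,1]$ is treated as a discrete index set). A Banach space (or its norm $\|\cdot\|$) is strictly convex if for all nonzero $x,y$, $\|x+y\|=\|x\|+\|y\|$ implies that there is $\lambda>0$ with $x=\lambda y$. Two norms $\|\cdot\|$ and $\|\cdot\|'$ on a space are equivalent if there are constants $c,C>0$ with $c\|x\|\le\|x\|'\le C\|x\|$ for all $x$. A subset $\mathcal{Y}$ of a Banach space is $r$-equilateral ($r>0$) if $\|x-y\|=r$ for any two distinct $x,y\in\mathcal{Y}$; it is equilateral if it is $r$-equilateral for some real $r>0$. *)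

theory Defs
  imports "HOL-Analysis.Analysis"
begin

typedef unit_interval = "{0..1::real}"
  by (rule exI[of _ 0]) simp

text \<open>The index type carries no topology: \<^const>\<open>infsum\<close> is the unordered sum over a
  (possibly uncountable) set, and for nonnegative real families \<^const>\<open>summable_on\<close>
  says exactly that this sum is finite.\<close>

typedef 'i ell1 = "{x :: 'i \<Rightarrow> real. (\<lambda>t. \<bar>x t\<bar>) summable_on UNIV}"
  morphisms ell1_apply Abs_ell1
  by (rule exI[of _ "\<lambda>_. 0"]) simp

setup_lifting type_definition_ell1

lemma ell1_summable_add:
  fixes x y :: "'i \<Rightarrow> real"
  assumes "(\<lambda>t. \<bar>x t\<bar>) summable_on UNIV" and "(\<lambda>t. \<bar>y t\<bar>) summable_on UNIV"
  shows "(\<lambda>t. \<bar>x t + y t\<bar>) summable_on UNIV"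
  by (rule summable_on_comparison_test[OF summable_on_add[OF assms]]) auto

lemma ell1_summable_scale:
  fixes x :: "'i \<Rightarrow> real"
  assumes "(\<lambda>t. \<bar>x t\<bar>) summable_on UNIV"
  shows "(\<lambda>t. \<bar>c * x t\<bar>) summable_on UNIV"
  using summable_on_cmult_right[OF assms, of "\<bar>c\<bar>"] by (simp add: abs_mult)

instantiation ell1 :: (type) real_vector
begin

lift_definition zero_ell1 :: "'a ell1" is "\<lambda>_. 0"
  by simp

lift_definition plus_ell1 :: "'a ell1 \<Rightarrow> 'a ell1 \<Rightarrow> 'a ell1" is "\<lambda>x y t. x t + y t"
  by (rule ell1_summable_add)

lift_definition uminus_ell1 :: "'a ell1 \<Rightarrow> 'a ell1" is "\<lambda>x t. - x t"
  by simp

lift_definition minus_ell1 :: "'a ell1 \<Rightarrow> 'a ell1 \<Rightarrow> 'a ell1" is "\<lambda>x y t. x t - y t"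
proof -
  fix x y :: "'a \<Rightarrow> real"
  assume "(\<lambda>t. \<bar>x t\<bar>) summable_on UNIV" and "(\<lambda>t. \<bar>y t\<bar>) summable_on UNIV"
  then show "(\<lambda>t. \<bar>x t - y t\<bar>) summable_on UNIV"
    using ell1_summable_add[of x "\<lambda>t. - y t"] by simp
qed

lift_definition scaleR_ell1 :: "real \<Rightarrow> 'a ell1 \<Rightarrow> 'a ell1" is "\<lambda>c x t. c * x t"
  by (rule ell1_summable_scale)

instance
  by standard (transfer; rule ext; simp add: distrib_left distrib_right)+

end

instantiation ell1 :: (type) real_normed_vector
begin

lift_definition norm_ell1 :: "'a ell1 \<Rightarrow> real" is "\<lambda>x. \<Sum>\<^sub>\<infinity>t\<in>UNIV. \<bar>x t\<bar>" .

definition dist_ell1 :: "'a ell1 \<Rightarrow> 'a ell1 \<Rightarrow> real"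
  where "dist_ell1 x y = norm (x - y)"

definition sgn_ell1 :: "'a ell1 \<Rightarrow> 'a ell1"
  where "sgn_ell1 x = x /\<^sub>R norm x"

definition uniformity_ell1 :: "('a ell1 \<times> 'a ell1) filter"
  where "uniformity_ell1 = (INF e\<in>{0<..}. principal {(x, y). dist x y < e})"

definition open_ell1 :: "'a ell1 set \<Rightarrow> bool"
  where "open_ell1 U \<longleftrightarrow> (\<forall>x\<in>U. \<forall>\<^sub>F (x', y) in uniformity. x' = x \<longrightarrow> y \<in> U)"

instance
proof
  fix x y :: "'a ell1" and c :: real
  show "norm x = 0 \<longleftrightarrow> x = 0"
  proof transfer
    fix x :: "'a \<Rightarrow> real"
    assume s: "(\<lambda>t. \<bar>x t\<bar>) summable_on UNIV"
    show "(\<Sum>\<^sub>\<infinity>t\<in>UNIV. \<bar>x t\<bar>) = 0 \<longleftrightarrow> x = (\<lambda>_. 0)"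
    proof
      assume z: "(\<Sum>\<^sub>\<infinity>t\<in>UNIV. \<bar>x t\<bar>) = 0"
      show "x = (\<lambda>_. 0)"
      proof
        fix t
        show "x t = 0"
          using nonneg_infsum_le_0D[OF eq_refl[OF z] s, of t] by simp
      qed
    qed simp
  qed
  show "norm (x + y) \<le> norm x + norm y"
  proof transfer
    fix x y :: "'a \<Rightarrow> real"
    assume s: "(\<lambda>t. \<bar>x t\<bar>) summable_on UNIV" "(\<lambda>t. \<bar>y t\<bar>) summable_on UNIV"
    have "(\<Sum>\<^sub>\<infinity>t\<in>UNIV. \<bar>x t + y t\<bar>) \<le> (\<Sum>\<^sub>\<infinity>t\<in>UNIV. \<bar>x t\<bar> + \<bar>y t\<bar>)"
      by (rule infsum_mono[OF ell1_summable_add[OF s] summable_on_add[OF s]]) auto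
    also have "\<dots> = (\<Sum>\<^sub>\<infinity>t\<in>UNIV. \<bar>x t\<bar>) + (\<Sum>\<^sub>\<infinity>t\<in>UNIV. \<bar>y t\<bar>)"
      by (rule infsum_add[OF s])
    finally show "(\<Sum>\<^sub>\<infinity>t\<in>UNIV. \<bar>x t + y t\<bar>) \<le> (\<Sum>\<^sub>\<infinity>t\<in>UNIV. \<bar>x t\<bar>) + (\<Sum>\<^sub>\<infinity>t\<in>UNIV. \<bar>y t\<bar>)" .
  qed
  show "norm (c *\<^sub>R x) = \<bar>c\<bar> * norm x"
    by transfer (simp add: abs_mult infsum_cmult_right')
qed (simp_all only: dist_ell1_def sgn_ell1_def uniformity_ell1_def open_ell1_def)

end

definition is_norm :: "('a::real_vector \<Rightarrow> real) \<Rightarrow> bool"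
  where "is_norm N \<longleftrightarrow>
    (\<forall>x. 0 \<le> N x) \<and> (\<forall>x. N x = 0 \<longleftrightarrow> x = 0) \<and>
    (\<forall>c x. N (c *\<^sub>R x) = \<bar>c\<bar> * N x) \<and> (\<forall>x y. N (x + y) \<le> N x + N y)"

definition equivalent_norms :: "('a::real_vector \<Rightarrow> real) \<Rightarrow> ('a \<Rightarrow> real) \<Rightarrow> bool"
  where "equivalent_norms N N' \<longleftrightarrow>
    is_norm N \<and> is_norm N' \<and> (\<exists>c>0. \<exists>C>0. \<forall>x. c * N x \<le> N' x \<and> N' x \<le> C * N x)"

definition strictly_convex :: "('a::real_vector \<Rightarrow> real) \<Rightarrow> bool"
  where "strictly_convex N \<longleftrightarrow>
    (\<forall>x y. x \<noteq> 0 \<longrightarrow> y \<noteq> 0 \<longrightarrow> N (x + y) = N x + N y \<longrightarrow> (\<exists>l>0. x = l *\<^sub>R y))"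

definition r_equilateral :: "('a::real_vector \<Rightarrow> real) \<Rightarrow> real \<Rightarrow> 'a set \<Rightarrow> bool"
  where "r_equilateral N r Y \<longleftrightarrow> (\<forall>x\<in>Y. \<forall>y\<in>Y. x \<noteq> y \<longrightarrow> N (x - y) = r)"

definition equilateral :: "('a::real_vector \<Rightarrow> real) \<Rightarrow> 'a set \<Rightarrow> bool"
  where "equilateral N Y \<longleftrightarrow> (\<exists>r>0. r_equilateral N r Y)"

definition compact_operator :: "('a::real_normed_vector \<Rightarrow> 'b::real_normed_vector) \<Rightarrow> bool"
  where "compact_operator T \<longleftrightarrow> bounded_linear T \<and> (\<forall>B. bounded B \<longrightarrow> compact (closure (T ` B)))"

definition norm_via :: "('a::real_normed_vector \<Rightarrow> 'b::real_normed_vector) \<Rightarrow> 'a \<Rightarrow> real"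
  where "norm_via T x = norm x + norm (T x)"

end

theory Submission
  imports Defs
begin

text \<open>
  Let \<open>Y\<close> be infinite and \<open>r\<close>-equilateral. By Tychonoff's theorem and compactness of \<open>T\<close>, along some
  nontrivial filter on \<open>Y\<close> that eventually avoids each single point, the points \<open>x\<close> converge
  coordinatewise to some \<open>x0\<close> in \<open>\<ell>\<^sub>1\<close> and \<open>T x\<close> converges in norm to some \<open>z\<close> (which need not be
  \<open>T x0\<close>). Mass escaping to infinity adds up in \<open>\<ell>\<^sub>1\<close>, so for fixed \<open>x\<close> in \<open>Y\<close> passing to the limit in
  \<open>\<parallel>x - y\<parallel>\<^sub>1 + \<parallel>T x - T y\<parallel> = r\<close> gives \<open>\<parallel>x - x0\<parallel>\<^sub>1 + a + \<parallel>T x - z\<parallel> = r\<close> with \<open>a = lim \<parallel>y - x0\<parallel>\<^sub>1\<close>; a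
  second limit gives \<open>a = r / 2\<close>. Hence every triangle inequality through \<open>x0\<close> and \<open>z\<close> is an
  equality, and by strict convexity the vectors \<open>T x - z\<close>, of which at most one is zero by
  injectivity, are pairwise negative multiples of each other. This is impossible for three of them.
\<close>

lemma ell1_has_sum_norm: "((\<lambda>t. \<bar>ell1_apply x t\<bar>) has_sum norm x) UNIV"
  by transfer (simp add: has_sum_infsum)

lemma ell1_sum_le_norm: "finite S \<Longrightarrow> (\<Sum>t\<in>S. \<bar>ell1_apply x t\<bar>) \<le> norm x"
  by (rule finite_sum_le_has_sum[OF ell1_has_sum_norm]) auto

lemma ell1_abs_apply_le_norm: "\<bar>ell1_apply x t\<bar> \<le> norm x"
  using ell1_sum_le_norm[of "{t}" x] by simp

text \<open>Coordinatewise, \<open>\<bar>v\<bar> + \<bar>y\<bar> - \<bar>v - y\<bar>\<close> is at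
  most twice either of \<open>\<bar>v\<bar>\<close>, \<open>\<bar>y\<bar>\<close>: bound it by
  \<open>y\<close> on \<open>S\<close> and by \<open>v\<close> off \<open>S\<close>.\<close>

lemma ell1_norm_diff_defect_le:
  assumes "finite S"
  shows "norm v + norm y - norm (v - y)
    \<le> 2 * (\<Sum>t\<in>S. \<bar>ell1_apply y t\<bar>) + 2 * (norm v - (\<Sum>t\<in>S. \<bar>ell1_apply v t\<bar>))"
proof -
  have fin: "((\<lambda>t. if t \<in> S then \<bar>ell1_apply w t\<bar> else 0) has_sum (\<Sum>t\<in>S. \<bar>ell1_apply w t\<bar>)) UNIV"
    for w :: "'a ell1"
    by (rule has_sum_finite_neutralI[OF assms]) auto
  have lhs: "((\<lambda>t. \<bar>ell1_apply v t\<bar> + \<bar>ell1_apply y t\<bar>) has_sum (norm v + norm y)) UNIV"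
    by (intro has_sum_add ell1_has_sum_norm)
  have rhs: "((\<lambda>t. \<bar>ell1_apply (v - y) t\<bar> + 2 * (if t \<in> S then \<bar>ell1_apply y t\<bar> else 0)
        + 2 * (\<bar>ell1_apply v t\<bar> + - (if t \<in> S then \<bar>ell1_apply v t\<bar> else 0)))
      has_sum (norm (v - y) + 2 * (\<Sum>t\<in>S. \<bar>ell1_apply y t\<bar>)
        + 2 * (norm v + - (\<Sum>t\<in>S. \<bar>ell1_apply v t\<bar>)))) UNIV"
    by (intro has_sum_add has_sum_uminusI has_sum_cmult_right ell1_has_sum_norm fin)
  have "norm v + norm y \<le> norm (v - y) + 2 * (\<Sum>t\<in>S. \<bar>ell1_apply y t\<bar>)
        + 2 * (norm v + - (\<Sum>t\<in>S. \<bar>ell1_apply v t\<bar>))"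
    by (rule has_sum_mono[OF lhs rhs]) (auto simp: minus_ell1.rep_eq)
  then show ?thesis by simp
qed

text \<open>A Brezis--Lieb type statement: far-away mass does not interact with \<open>v\<close>.\<close>

lemma ell1_tendsto_norm_diff_minus_norm:
  assumes "\<And>t. ((\<lambda>i. ell1_apply (y i) t) \<longlongrightarrow> 0) F"
  shows "((\<lambda>i. norm (v - y i) - norm (y i)) \<longlongrightarrow> norm v) F"
proof (rule tendstoI)
  fix e :: real
  assume "0 < e"
  \<comment> \<open>Both error terms enter the defect bound doubled, so \<open>e / 4\<close> for
    each keeps the total below \<open>e\<close>.\<close>
  then obtain S where S: "finite S" "dist (\<Sum>t\<in>S. \<bar>ell1_apply v t\<bar>) (norm v) \<le> e / 4"
    using has_sum_finite_approximation[OF ell1_has_sum_norm[of v], of "e / 4"] by auto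
  have "((\<lambda>i. \<Sum>t\<in>S. \<bar>ell1_apply (y i) t\<bar>) \<longlongrightarrow> (\<Sum>t\<in>S. \<bar>0\<bar>)) F"
    by (intro tendsto_sum tendsto_rabs assms)
  then have "\<forall>\<^sub>F i in F. (\<Sum>t\<in>S. \<bar>ell1_apply (y i) t\<bar>) < e / 4"
    using \<open>0 < e\<close> by (intro order_tendstoD(2)[where y = 0]) simp_all
  then show "\<forall>\<^sub>F i in F. dist (norm (v - y i) - norm (y i)) (norm v) < e"
  proof eventually_elim
    case (elim i)
    have "norm v - (\<Sum>t\<in>S. \<bar>ell1_apply v t\<bar>) \<le> e / 4"
      using abs_le_D2[OF S(2)[unfolded dist_real_def]] by simp
    then show ?case
      using ell1_norm_diff_defect_le[OF S(1), of v "y i"] elim norm_triangle_ineq4[of v "y i"] \<open>0 < e\<close>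
      by (simp add: dist_real_def abs_less_iff)
  qed
qed

text \<open>A Fatou argument: finite partial sums pass to the limit and keep the bound
  \<open>M\<close>.\<close>

lemma ell1_pointwise_limit:
  assumes "F \<noteq> bot" and "\<forall>\<^sub>F i in F. norm (x i) \<le> M"
    and lim: "\<And>t. ((\<lambda>i. ell1_apply (x i) t) \<longlongrightarrow> p t) F"
  obtains x0 where "ell1_apply x0 = p"
proof -
  have "(\<Sum>t\<in>S. \<bar>p t\<bar>) \<le> M" if "finite S" for S
  proof (rule tendsto_upperbound[OF _ _ \<open>F \<noteq> bot\<close>])
    show "((\<lambda>i. \<Sum>t\<in>S. \<bar>ell1_apply (x i) t\<bar>) \<longlongrightarrow> (\<Sum>t\<in>S. \<bar>p t\<bar>)) F"
      by (intro tendsto_sum tendsto_rabs lim)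
    show "\<forall>\<^sub>F i in F. (\<Sum>t\<in>S. \<bar>ell1_apply (x i) t\<bar>) \<le> M"
      using assms(2) by eventually_elim (use ell1_sum_le_norm[OF that] order_trans in blast)
  qed
  then have "(\<lambda>t. \<bar>p t\<bar>) summable_on UNIV"
    by (intro nonneg_bdd_above_summable_on) (auto intro!: bdd_aboveI)
  then show thesis
    using that[of "Abs_ell1 p"] by (simp add: Abs_ell1_inverse)
qed

lemma compact_PiE_UNIV:
  fixes K :: "'i \<Rightarrow> 'a::topological_space set"
  assumes "\<And>t. compact (K t)"
  shows "compact (PiE UNIV K)"
proof -
  have "compactin (product_topology (\<lambda>_. euclidean) UNIV) (PiE UNIV K)"
    using assms by (auto simp: compactin_PiE)
  then show ?thesis
    by (simp add: euclidean_product_topology)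
qed

text \<open>Replaces the choice of a convergent subsequence, since products over uncountable index
  sets need not be sequentially compact. \<open>G\<close> refines \<open>F\<close> by preimages of
  neighbourhoods of a cluster point.\<close>

lemma compact_cluster_filter:
  assumes "compact K" and "F \<noteq> bot" and "\<forall>\<^sub>F x in F. f x \<in> K"
  obtains p G where "G \<noteq> bot" "G \<le> F" "(f \<longlongrightarrow> p) G"
proof -
  obtain p where p: "inf (nhds p) (filtermap f F) \<noteq> bot"
    using assms(1)[unfolded compact_filter, rule_format, of "filtermap f F"] assms(2,3)
    by (auto simp: eventually_filtermap filtermap_bot_iff)
  let ?G = "inf F (filtercomap f (nhds p))"
  have "?G \<noteq> bot"
  proof
    assume "?G = bot"
    then have "eventually (\<lambda>_. False) ?G" by simp
    then obtain P Q where "eventually P F" "eventually Q (filtercomap f (nhds p))"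
      and PQ: "\<And>x. P x \<Longrightarrow> Q x \<Longrightarrow> False"
      unfolding eventually_inf by blast
    then obtain R where R: "eventually R (nhds p)" and RQ: "\<And>x. R (f x) \<Longrightarrow> Q x"
      by (auto simp: eventually_filtercomap)
    have "eventually (\<lambda>y. \<not> R y) (filtermap f F)"
      unfolding eventually_filtermap
      using \<open>eventually P F\<close> by eventually_elim (use PQ RQ in blast)
    with R have "eventually (\<lambda>_. False) (inf (nhds p) (filtermap f F))"
      unfolding eventually_inf by blast
    with p show False by simp
  qed
  moreover have "(f \<longlongrightarrow> p) ?G"
    unfolding filterlim_iff_le_filtercomap by simp
  ultimately show thesis using that by simp
qed

text \<open>Signs clash: going through \<open>v\<close>, \<open>u\<close> is a positive multiple of
  \<open>w\<close>, yet directly it is a negative one.\<close>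

lemma strictly_convex_no_three_opposite:
  assumes sc: "strictly_convex (norm :: 'x::real_normed_vector \<Rightarrow> real)"
    and "u \<noteq> (0::'x)" "v \<noteq> 0" "w \<noteq> 0"
    and "norm (u - v) = norm u + norm v" "norm (v - w) = norm v + norm w"
    and "norm (u - w) = norm u + norm w"
  shows False
proof -
  have opp: "\<exists>l>0. a = - l *\<^sub>R b"
    if "a \<noteq> 0" "b \<noteq> 0" "norm (a - b) = norm a + norm b" for a b :: 'x
    using sc[unfolded strictly_convex_def, rule_format, of a "- b"] that by simp
  obtain k where k: "k > 0" "u = - k *\<^sub>R v" using opp assms by blast
  obtain l where l: "l > 0" "v = - l *\<^sub>R w" using opp assms by blast
  obtain m where m: "m > 0" "u = - m *\<^sub>R w" using opp assms by blast
  have "(k * l + m) *\<^sub>R w = 0"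
    using k(2) m(2) unfolding l(2) scaleR_add_left by (simp add: eq_neg_iff_add_eq_0[symmetric])
  moreover have "k * l + m > 0"
    using k(1) l(1) m(1) by (simp add: add_pos_pos)
  ultimately show False using \<open>w \<noteq> 0\<close> by simp
qed

lemma infinite_obtain_three:
  assumes "infinite A"
  obtains a b c where "a \<in> A" "b \<in> A" "c \<in> A" "a \<noteq> b" "b \<noteq> c" "a \<noteq> c"
proof -
  obtain B where "B \<subseteq> A" "card B = 3"
    using infinite_arbitrarily_large[OF assms] by blast
  then show thesis
    using that unfolding card_3_iff by blast
qed

lemma no_infinite_equilateral_norm_via:
  fixes T :: "'i ell1 \<Rightarrow> 'x::real_normed_vector"
  assumes sc: "strictly_convex (norm :: 'x \<Rightarrow> real)"
    and T: "compact_operator T" "inj T"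
    and "infinite Y"
  shows "\<not> equilateral (norm_via T) Y"
proof
  assume "equilateral (norm_via T) Y"
  then obtain r where r: "norm (x - y) + norm (T x - T y) = r"
    if "x \<in> Y" "y \<in> Y" "x \<noteq> y" for x y
    using T(1) unfolding equilateral_def r_equilateral_def norm_via_def compact_operator_def
    by (metis bounded_linear.linear linear_diff)
  obtain y0 where "y0 \<in> Y"
    using \<open>infinite Y\<close> by (metis finite.emptyI ex_in_conv)
  \<comment> \<open>Other points of \<open>Y\<close> are within \<open>r\<close> of
    \<open>y0\<close>; the absolute value covers \<open>y0\<close> itself.\<close>
  define M where "M = norm y0 + \<bar>r\<bar>"
  have M: "norm x \<le> M" if "x \<in> Y" for x
  proof (cases "x = y0")
    case False
    then show ?thesis
      using r[OF that \<open>y0 \<in> Y\<close>] norm_triangle_sub[of x y0] norm_ge_zero[of "T x - T y0"]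
      unfolding M_def by linarith
  qed (simp add: M_def)
  then have "bounded Y" by (auto simp: bounded_iff)
  then have cT: "compact (closure (T ` Y))"
    using T(1) by (auto simp: compact_operator_def)

  define F where "F = inf cofinite (principal Y)"
  have F: "eventually P F \<longleftrightarrow> finite {x\<in>Y. \<not> P x}" for P
    unfolding F_def eventually_inf_principal eventually_cofinite by (simp add: conj_commute)
  have "F \<noteq> bot"
    using \<open>infinite Y\<close> F[of "\<lambda>_. False"] by auto
  have F_Y: "\<forall>\<^sub>F x in F. x \<in> Y" by (simp add: F)
  have F_neq: "\<forall>\<^sub>F x in F. x \<noteq> y" for y by (simp add: F)
  \<comment> \<open>Treating the pair at once yields a single filter for both limits.\<close>
  let ?K = "PiE UNIV (\<lambda>_. {-M..M}) \<times> closure (T ` Y)"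
  have "compact ?K"
    by (intro compact_Times compact_PiE_UNIV cT) auto
  moreover have "\<forall>\<^sub>F x in F. (ell1_apply x, T x) \<in> ?K"
    using F_Y
  proof eventually_elim
    case (elim x)
    have "ell1_apply x t \<in> {-M..M}" for t
      using ell1_abs_apply_le_norm[of x t] M[OF elim] by auto
    moreover have "T x \<in> closure (T ` Y)"
      using elim by (intro closure_subset[THEN subsetD] imageI)
    ultimately show ?case by (simp add: PiE_iff)
  qed
  ultimately obtain pz G where G: "G \<noteq> bot" "G \<le> F"
    and pz: "((\<lambda>x. (ell1_apply x, T x)) \<longlongrightarrow> pz) G"
    by (rule compact_cluster_filter[OF _ \<open>F \<noteq> bot\<close>])
  obtain p z where [simp]: "pz = (p, z)" by (cases pz)
  have limT: "(T \<longlongrightarrow> z) G"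
    using tendsto_snd[OF pz] by simp
  have "(ell1_apply \<longlongrightarrow> p) G"
    using tendsto_fst[OF pz] by simp
  then have limp: "((\<lambda>x. ell1_apply x t) \<longlongrightarrow> p t) G" for t
    by (rule continuous_on_tendsto_compose[OF continuous_on_product_coordinates]) auto
  have G_Y: "\<forall>\<^sub>F x in G. x \<in> Y" and G_neq: "\<forall>\<^sub>F x in G. x \<noteq> y" for y
    using F_Y F_neq G(2) by (auto simp: le_filter_def)
  have "\<forall>\<^sub>F x in G. norm x \<le> M"
    using G_Y by eventually_elim (rule M)
  then obtain x0 where x0: "ell1_apply x0 = p"
    using ell1_pointwise_limit[OF G(1) _ limp] by blast
  have lim0: "((\<lambda>x. ell1_apply (x - x0) t) \<longlongrightarrow> 0) G" for t
    using tendsto_diff[OF limp[of t] tendsto_const[of "p t"]] by (simp add: minus_ell1.rep_eq x0)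

  \<comment> \<open>Convergence of \<open>norm (y - x0)\<close> is not known beforehand: solving the
    equilateral identity for it gives the limit, whose value cannot depend on
    \<open>x\<close>.\<close>
  have lim_norm: "((\<lambda>y. norm (y - x0)) \<longlongrightarrow> r - norm (T x - z) - norm (x - x0)) G"
    if "x \<in> Y" for x
  proof (rule Lim_transform_eventually)
    show "((\<lambda>y. r - norm (T x - T y) - (norm ((x - x0) - (y - x0)) - norm (y - x0)))
        \<longlongrightarrow> r - norm (T x - z) - norm (x - x0)) G"
      by (intro tendsto_diff tendsto_norm tendsto_const limT ell1_tendsto_norm_diff_minus_norm lim0)
    show "\<forall>\<^sub>F y in G. r - norm (T x - T y) - (norm ((x - x0) - (y - x0)) - norm (y - x0))
        = norm (y - x0)"
      using G_Y G_neq[of x] by eventually_elim (use r[OF that] in force)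
  qed
  define a where "a = r - norm (T y0 - z) - norm (y0 - x0)"
  have lima: "((\<lambda>y. norm (y - x0)) \<longlongrightarrow> a) G"
    unfolding a_def by (rule lim_norm[OF \<open>y0 \<in> Y\<close>])
  have a: "norm (T x - z) + norm (x - x0) = r - a" if "x \<in> Y" for x
    using tendsto_unique[OF G(1) lima lim_norm[OF that]] by simp
  \<comment> \<open>Now \<open>x\<close> itself runs along \<open>G\<close>, although the sum is
    constant on \<open>Y\<close>.\<close>
  have "((\<lambda>x. norm (T x - z) + norm (x - x0)) \<longlongrightarrow> norm (z - z) + a) G"
    by (intro tendsto_add tendsto_norm tendsto_diff limT lima tendsto_const)
  moreover have "((\<lambda>x. norm (T x - z) + norm (x - x0)) \<longlongrightarrow> r - a) G"
    by (rule tendsto_eventually) (use G_Y in eventually_elim, rule a)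
  ultimately have "norm (z - z) + a = r - a"
    by (rule tendsto_unique[OF G(1)])
  then have "r = 2 * a" by simp

  \<comment> \<open>The two triangle inequalities add up to \<open>r \<le> 2 * (r - a) = r\<close>,
    so both are equalities.\<close>
  have tri: "norm ((T x - z) - (T y - z)) = norm (T x - z) + norm (T y - z)"
    if "x \<in> Y" "y \<in> Y" "x \<noteq> y" for x y
    using r[OF that] a[OF that(1)] a[OF that(2)] \<open>r = 2 * a\<close>
      norm_triangle_ineq4[of "x - x0" "y - x0"] norm_triangle_ineq4[of "T x - z" "T y - z"]
    by simp
  have "finite (T -` {z})"
    by (rule finite_vimageI[OF _ \<open>inj T\<close>]) simp
  then have "infinite (Y - T -` {z})"
    using \<open>infinite Y\<close> by simp
  then obtain x y w where "x \<in> Y - T -` {z}" "y \<in> Y - T -` {z}" "w \<in> Y - T -` {z}"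
    "x \<noteq> y" "y \<noteq> w" "x \<noteq> w"
    by (rule infinite_obtain_three)
  then show False
    by (intro strictly_convex_no_three_opposite[OF sc, of "T x - z" "T y - z" "T w - z"] tri) auto
qed

lemma equivalent_norms_norm_via:
  assumes "bounded_linear T"
  shows "equivalent_norms norm (norm_via T)"
proof -
  interpret bounded_linear T by fact
  obtain K where K: "K > 0" "\<And>x. norm (T x) \<le> norm x * K"
    using pos_bounded by blast
  have "is_norm (norm :: 'a \<Rightarrow> real)"
    by (simp add: is_norm_def norm_triangle_ineq)
  moreover have "is_norm (norm_via T)"
    unfolding is_norm_def norm_via_def
  proof (intro conjI allI)
    show "norm x + norm (T x) = 0 \<longleftrightarrow> x = 0" for x
      by (auto simp: add_nonneg_eq_0_iff zero)
    show "norm (x + y) + norm (T (x + y)) \<le> norm x + norm (T x) + (norm y + norm (T y))" for x y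
      using norm_triangle_ineq[of x y] norm_triangle_ineq[of "T x" "T y"] by (simp add: add)
  qed (auto simp: scaleR distrib_left)
  moreover have "1 * norm x \<le> norm_via T x \<and> norm_via T x \<le> (1 + K) * norm x" for x
    using K(2)[of x] by (simp add: norm_via_def algebra_simps)
  ultimately show ?thesis
    unfolding equivalent_norms_def using K(1) by (meson add_pos_pos zero_less_one)
qed

theorem theorem1:
  fixes T :: "unit_interval ell1 \<Rightarrow> 'x::banach"
  assumes "strictly_convex (norm :: 'x \<Rightarrow> real)"
    and "bounded_linear T"
    and "compact_operator T"
    and "inj T"
  shows "equivalent_norms norm (norm_via T) \<and>
    \<not> (\<exists>Y. infinite Y \<and> equilateral (norm_via T) Y)"
  using equivalent_norms_norm_via no_infinite_equilateral_norm_via assms by blast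

end
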